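(* Let $X$ be a 1-walk regular graph with clique number $\omega$. Let $Y$ be any graph on at most $\omega$ vertices. For any two injective maps $\iota_1,\iota_2:V(Y)\to V(X)$ whose images are cliques of $X$, let $X_j$ ($j=1,2$) be the graph obtained from $X$ by deleting the edges $\{\iota_j(a),\iota_j(b)\}$ for all edges $\{a,b\}$ of $Y$. Then $X_1$ and $X_2$ are cospectral with respect to the adjacency matrix, the Laplacian matrix, the unsigned Laplacian matrix and the normalized Laplacian matrix.
   Context: A graph is 1-walk regular if for every positive integer $k$ the number of closed walks of length $k$ at a vertex is the same for all vertices, and the number of walks of length $k$ from $u$ to $v$ is the same for all pairs of adjacent vertices $u,v$. The clique number is the largest size of a set of pairwise adjacent vertices. With $A$ the adjacency matrix and $D$ the diagonal degree matrix: Laplacian $L=D-A$, unsigned Laplacian $S=D+A$, normalized Laplacian $N=D^{-1/2}LD^{-1/2}$ (for graphs without isolated vertices). Cospectral with respect to a matrix means the characteristic polynomials of those matrices coincide. *)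

theory Defs
  imports Complex_Main "Graph_Theory.Pair_Digraph" "Jordan_Normal_Form.Char_Poly"
begin

text \<open>Finite simple graphs are the \<^locale>\<open>pair_graph\<close>s: an undirected edge \<open>{u, v}\<close> is the pair of
  arcs \<open>(u, v)\<close>, \<open>(v, u)\<close>. Hence \<^const>\<open>out_degree\<close> is the degree.\<close>

definition num_walks :: "'a pair_pre_digraph \<Rightarrow> nat \<Rightarrow> 'a \<Rightarrow> 'a \<Rightarrow> nat" where
  "num_walks G k u v = card {p. pre_digraph.awalk (with_proj G) u p v \<and> length p = k}"

definition one_walk_regular :: "'a pair_pre_digraph \<Rightarrow> bool" where
  "one_walk_regular G \<longleftrightarrow>
    (\<forall>k\<ge>1. (\<forall>u\<in>pverts G. \<forall>v\<in>pverts G. num_walks G k u u = num_walks G k v v) \<and>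
           (\<forall>(u, v)\<in>parcs G. \<forall>(u', v')\<in>parcs G. num_walks G k u v = num_walks G k u' v'))"

definition is_clique :: "'a pair_pre_digraph \<Rightarrow> 'a set \<Rightarrow> bool" where
  "is_clique G K \<longleftrightarrow> K \<subseteq> pverts G \<and> (\<forall>u\<in>K. \<forall>v\<in>K. u \<noteq> v \<longrightarrow> (u, v) \<in> parcs G)"

definition clique_number :: "'a pair_pre_digraph \<Rightarrow> nat" where
  "clique_number G = Max (card ` {K. is_clique G K})"

definition delete_copy ::
  "'a pair_pre_digraph \<Rightarrow> 'b pair_pre_digraph \<Rightarrow> ('b \<Rightarrow> 'a) \<Rightarrow> 'a pair_pre_digraph" where
  "delete_copy X Y f = \<lparr> pverts = pverts X, parcs = parcs X - {(f a, f b) | a b. (a, b) \<in> parcs Y} \<rparr>"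

text \<open>The matrices of a graph are indexed by \<open>0, \<dots>, n - 1\<close> through an enumeration \<open>vs\<close> of
  its vertices.\<close>

definition vertex_enum :: "'a pair_pre_digraph \<Rightarrow> 'a list \<Rightarrow> bool" where
  "vertex_enum G vs \<longleftrightarrow> distinct vs \<and> set vs = pverts G"

definition adjacency_matrix :: "'a list \<Rightarrow> 'a pair_pre_digraph \<Rightarrow> real mat" where
  "adjacency_matrix vs G =
    mat (length vs) (length vs) (\<lambda>(i, j). if (vs ! i, vs ! j) \<in> parcs G then 1 else 0)"

definition degree_matrix :: "'a list \<Rightarrow> 'a pair_pre_digraph \<Rightarrow> real mat" where
  "degree_matrix vs G = mat (length vs) (length vs)
    (\<lambda>(i, j). if i = j then real (out_degree (with_proj G) (vs ! i)) else 0)"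

definition laplacian_matrix :: "'a list \<Rightarrow> 'a pair_pre_digraph \<Rightarrow> real mat" where
  "laplacian_matrix vs G = degree_matrix vs G - adjacency_matrix vs G"

definition unsigned_laplacian_matrix :: "'a list \<Rightarrow> 'a pair_pre_digraph \<Rightarrow> real mat" where
  "unsigned_laplacian_matrix vs G = degree_matrix vs G + adjacency_matrix vs G"

text \<open>At an isolated vertex, the diagonal entry of \<open>D\<^sup>-\<^sup>1\<^sup>/\<^sup>2\<close> is \<open>1 / sqrt 0 = 0\<close>, which is the usual
  convention extending the normalized Laplacian to graphs with isolated vertices.\<close>

definition inv_sqrt_degree_matrix :: "'a list \<Rightarrow> 'a pair_pre_digraph \<Rightarrow> real mat" where
  "inv_sqrt_degree_matrix vs G = mat (length vs) (length vs)
    (\<lambda>(i, j). if i = j then 1 / sqrt (real (out_degree (with_proj G) (vs ! i))) else 0)"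

definition normalized_laplacian_matrix :: "'a list \<Rightarrow> 'a pair_pre_digraph \<Rightarrow> real mat" where
  "normalized_laplacian_matrix vs G =
    inv_sqrt_degree_matrix vs G * laplacian_matrix vs G * inv_sqrt_degree_matrix vs G"

text \<open>The characteristic polynomial does not depend on the enumeration, so quantifying over all
  enumerations of both graphs is harmless; a finite graph always has one.\<close>

definition cospectral ::
  "('a list \<Rightarrow> 'a pair_pre_digraph \<Rightarrow> real mat) \<Rightarrow> 'a pair_pre_digraph \<Rightarrow> 'a pair_pre_digraph \<Rightarrow> bool" where
  "cospectral M G H \<longleftrightarrow>
    (\<forall>vs ws. vertex_enum G vs \<longrightarrow> vertex_enum H ws \<longrightarrow> char_poly (M vs G) = char_poly (M ws H))"

end

theory Submission
  imports Defs
begin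

text \<open>
  Extend \<open>\<iota>\<^sub>2 \<circ> \<iota>\<^sub>1\<^sup>-\<^sup>1\<close> to a permutation \<open>\<pi>\<close> of the vertices of \<open>X\<close>. In the enumerations \<open>vs\<close> and
  \<open>map \<pi> vs\<close>, the two perturbed graphs arise from adjacency matrices \<open>A\<close> and \<open>A'\<close> of \<open>X\<close> by the
  same correction, supported on the block indexed by the clique, and 1-walk regularity says that
  all powers of \<open>A\<close> and \<open>A'\<close> agree on that block. Hence so do the resolvents \<open>R\<close> and \<open>R'\<close> at any
  \<open>y\<close> with \<open>\<bar>y\<bar> > n\<close>: on the block, \<open>A\<^sup>k R - A'\<^sup>k R' = y\<^sup>k (R - R')\<close> while the left-hand side is
  \<open>O(n\<^sup>k)\<close>. By \<open>det (1 + P Q) = det (1 + Q P)\<close>, the determinant of \<open>y - A + C\<close> for \<open>C\<close> supported on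
  the block depends only on \<open>det (y - A)\<close>, \<open>C\<close> and the block of the resolvent. As \<open>X\<close> is regular,
  each of the four characteristic polynomials at \<open>x < - n\<close> is a common factor times such a
  determinant.
\<close>


section \<open>Determinants, resolvents and perturbations supported on a block\<close>

text \<open>Both sides are the determinant of the block matrix with rows \<open>(1, - P)\<close> and
  \<open>(Q, 1)\<close>. The formula for commuting lower blocks gives the left side, and splitting
  off a unipotent lower triangular factor gives the right side.\<close>

lemma det_one_plus_mult_commute:
  fixes P Q :: "'a :: idom mat"
  assumes P: "P \<in> carrier_mat n n" and Q: "Q \<in> carrier_mat n n"
  shows "det (1\<^sub>m n + P * Q) = det (1\<^sub>m n + Q * P)"
proof -
  let ?I = "1\<^sub>m n :: 'a mat" and ?Z = "0\<^sub>m n n :: 'a mat"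
  have mP: "- P \<in> carrier_mat n n" and QP: "?I + Q * P \<in> carrier_mat n n"
    using P Q by auto
  have "Q * (- P) + (?I + Q * P) = ?I"
    using P Q by (intro eq_matI) auto
  hence fact: "four_block_mat ?I (- P) Q ?I
      = four_block_mat ?I ?Z Q ?I * four_block_mat ?I (- P) ?Z (?I + Q * P)"
    using P Q mP QP by (subst mult_four_block_mat[of _ n n _ n _ n _ _ n _ n]) auto
  have "?I * ?I - (- P) * Q = ?I + P * Q"
    using P Q by (intro eq_matI) auto
  hence "det (?I + P * Q) = det (four_block_mat ?I (- P) Q ?I)"
    using det_four_block_mat[of ?I n "- P" Q ?I] mP Q by simp
  also have "\<dots> = det (four_block_mat ?I ?Z Q ?I) * det (four_block_mat ?I (- P) ?Z (?I + Q * P))"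
    unfolding fact by (rule det_mult[of _ "n + n"]) (use P Q QP in auto)
  also have "\<dots> = det (?I + Q * P)"
    using det_four_block_mat_upper_right_zero[of ?I n ?Z n Q ?I]
      det_four_block_mat_lower_left_zero[of ?I n "- P" n ?Z "?I + Q * P"] P Q mP QP by simp
  finally show ?thesis .
qed

text \<open>Dividing by \<open>\<bar>y\<bar> ^ k\<close> leaves a bound by a multiple of the powers
  of a ratio below 1, which tend to 0. This lets resolvents be compared without summing a Neumann
  series of matrices.\<close>

lemma zero_if_power_growth_exceeded:
  fixes e y c C :: real
  assumes "\<And>k. \<bar>y\<bar> ^ k * \<bar>e\<bar> \<le> C * c ^ k" and "0 \<le> c" and "c < \<bar>y\<bar>"
  shows "e = 0"
proof -
  have "\<bar>e\<bar> \<le> C * (c / \<bar>y\<bar>) ^ k" for k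
    using assms(1)[of k] assms(2,3) by (simp add: power_divide field_simps)
  moreover have "(\<lambda>k. C * (c / \<bar>y\<bar>) ^ k) \<longlonglongrightarrow> C * 0"
    using assms(2,3) by (intro tendsto_intros LIMSEQ_power_zero) auto
  ultimately have "\<bar>e\<bar> \<le> 0"
    by (intro LIMSEQ_le_const) auto
  thus ?thesis by simp
qed

text \<open>Each multiplication by \<open>A\<close> adds up \<open>n\<close> terms with a factor of
  modulus at most 1. This crude growth rate is the source of the threshold
  \<open>real n < \<bar>y\<bar>\<close> used below.\<close>

lemma abs_pow_mat_index_le:
  fixes A :: "real mat"
  assumes A: "A \<in> carrier_mat n n"
    and le: "\<And>i j. i < n \<Longrightarrow> j < n \<Longrightarrow> \<bar>A $$ (i, j)\<bar> \<le> 1"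
    and "i < n" "j < n"
  shows "\<bar>(A ^\<^sub>m k) $$ (i, j)\<bar> \<le> real n ^ k"
  using \<open>i < n\<close> \<open>j < n\<close>
proof (induction k arbitrary: i j)
  case 0
  then show ?case using A by auto
next
  case (Suc k)
  have "(A ^\<^sub>m Suc k) $$ (i, j) = (\<Sum>l = 0..<n. (A ^\<^sub>m k) $$ (i, l) * A $$ (l, j))"
    using A Suc.prems by (simp add: scalar_prod_def)
  also have "\<bar>\<dots>\<bar> \<le> (\<Sum>l = 0..<n. \<bar>(A ^\<^sub>m k) $$ (i, l) * A $$ (l, j)\<bar>)"
    by (rule sum_abs)
  also have "\<dots> \<le> (\<Sum>l = 0..<n. real n ^ k * 1)"
    unfolding abs_mult by (intro sum_mono mult_mono) (use Suc le in auto)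
  finally show ?case by simp
qed

lemma smult_one_mat_mult_vec:
  assumes "v \<in> carrier_vec n"
  shows "(y \<cdot>\<^sub>m 1\<^sub>m n) *\<^sub>v v = y \<cdot>\<^sub>v (v :: 'a :: comm_ring_1 vec)"
  using assms by (intro eq_vecI) (auto simp: row_smult)

text \<open>A kernel vector would be an eigenvector for \<open>y\<close>, so its coordinates times
  \<open>y ^ k\<close> would be coordinates of \<open>A ^\<^sub>m k *\<^sub>v v\<close>, which grow
  only like \<open>real n ^ k\<close>. Hence all of them vanish.\<close>

lemma det_resolvent_nonzero:
  fixes A :: "real mat"
  assumes A: "A \<in> carrier_mat n n"
    and le: "\<And>i j. i < n \<Longrightarrow> j < n \<Longrightarrow> \<bar>A $$ (i, j)\<bar> \<le> 1"
    and y: "real n < \<bar>y\<bar>"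
  shows "det (y \<cdot>\<^sub>m 1\<^sub>m n - A) \<noteq> 0"
proof
  assume "det (y \<cdot>\<^sub>m 1\<^sub>m n - A) = 0"
  then obtain v where v: "v \<in> carrier_vec n" "v \<noteq> 0\<^sub>v n" "(y \<cdot>\<^sub>m 1\<^sub>m n - A) *\<^sub>v v = 0\<^sub>v n"
    using det_0_iff_vec_prod_zero[OF minus_carrier_mat[OF A]] by blast
  have "(y \<cdot>\<^sub>m 1\<^sub>m n - A) *\<^sub>v v = y \<cdot>\<^sub>v v - A *\<^sub>v v"
    using A v(1) by (simp add: minus_mult_distrib_mat_vec[of _ n n] smult_one_mat_mult_vec)
  hence "(y \<cdot>\<^sub>v v - A *\<^sub>v v) $ i = 0" if "i < n" for i
    using v(3) that by (metis index_zero_vec(1))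
  hence "A *\<^sub>v v = y \<cdot>\<^sub>v v"
    using A v(1) by (intro eq_vecI) auto
  hence "eigenvector A v y"
    using A v by (simp add: eigenvector_def)
  note pow = eigenvector_pow[OF A this]
  have "v $ i = 0" if i: "i < n" for i
  proof (rule zero_if_power_growth_exceeded[OF _ _ y])
    fix k
    have "\<bar>y\<bar> ^ k * \<bar>v $ i\<bar> = \<bar>(A ^\<^sub>m k *\<^sub>v v) $ i\<bar>"
      using pow[of k] v(1) i by (simp add: abs_mult power_abs)
    also have "(A ^\<^sub>m k *\<^sub>v v) $ i = (\<Sum>l = 0..<n. (A ^\<^sub>m k) $$ (i, l) * v $ l)"
      using A v(1) i by (simp add: scalar_prod_def)
    also have "\<bar>\<dots>\<bar> \<le> (\<Sum>l = 0..<n. \<bar>(A ^\<^sub>m k) $$ (i, l) * v $ l\<bar>)"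
      by (rule sum_abs)
    also have "\<dots> \<le> (\<Sum>l = 0..<n. real n ^ k * \<bar>v $ l\<bar>)"
      unfolding abs_mult using abs_pow_mat_index_le[OF A le] i
      by (intro sum_mono mult_right_mono) auto
    finally show "\<bar>y\<bar> ^ k * \<bar>v $ i\<bar> \<le> (\<Sum>l = 0..<n. \<bar>v $ l\<bar>) * real n ^ k"
      by (simp add: sum_distrib_left mult.commute)
  qed simp
  hence "v = 0\<^sub>v n"
    using v(1) by (intro eq_vecI) auto
  thus False using v(2) by simp
qed

text \<open>The argument works at one entry at a time: agreement of all powers at
  \<open>(i, j)\<close> suffices for agreement of the resolvents there, although the products with
  the resolvents involve other entries as well. Those are only bounded, never compared.\<close>

lemma resolvent_index_eq:
  fixes A A' R R' :: "real mat"
  assumes A: "A \<in> carrier_mat n n" and A': "A' \<in> carrier_mat n n"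
    and R: "R \<in> carrier_mat n n" and R': "R' \<in> carrier_mat n n"
    and inv: "(y \<cdot>\<^sub>m 1\<^sub>m n - A) * R = 1\<^sub>m n" "(y \<cdot>\<^sub>m 1\<^sub>m n - A') * R' = 1\<^sub>m n"
    and le: "\<And>i j. i < n \<Longrightarrow> j < n \<Longrightarrow> \<bar>A $$ (i, j)\<bar> \<le> 1"
    and le': "\<And>i j. i < n \<Longrightarrow> j < n \<Longrightarrow> \<bar>A' $$ (i, j)\<bar> \<le> 1"
    and y: "real n < \<bar>y\<bar>"
    and i: "i < n" and j: "j < n"
    and pow: "\<And>k. (A ^\<^sub>m k) $$ (i, j) = (A' ^\<^sub>m k) $$ (i, j)"
  shows "R $$ (i, j) = R' $$ (i, j)"
proof -
  \<comment> \<open>The resolvent equation reads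
    \<open>B * S = y \<cdot>\<^sub>m S - 1\<^sub>m n\<close>; multiplying it by
    \<open>B ^\<^sub>m k\<close> from the left gives a recursion in \<open>k\<close>.\<close>
  have step: "(B ^\<^sub>m Suc k * S) $$ (i, j) = y * (B ^\<^sub>m k * S) $$ (i, j) - (B ^\<^sub>m k) $$ (i, j)"
    if B: "B \<in> carrier_mat n n" and S: "S \<in> carrier_mat n n"
      and BS: "(y \<cdot>\<^sub>m 1\<^sub>m n - B) * S = 1\<^sub>m n" for B S :: "real mat" and k
  proof -
    have "y \<cdot>\<^sub>m S - B * S = 1\<^sub>m n"
      using BS B S by (simp add: minus_mult_distrib_mat[of _ n n] mult_smult_assoc_mat[of _ n n _ n])
    hence "(y \<cdot>\<^sub>m S - B * S) $$ (a, b) = 1\<^sub>m n $$ (a, b)" for a b by simp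
    hence "y * S $$ (a, b) - (B * S) $$ (a, b) = 1\<^sub>m n $$ (a, b)" if "a < n" "b < n" for a b
      using that B S by (metis carrier_matD index_minus_mat(1) index_mult_mat(2,3) index_smult_mat(1))
    hence "B * S = y \<cdot>\<^sub>m S - 1\<^sub>m n"
      using B S by (intro eq_matI) (auto simp: algebra_simps simp del: index_mult_mat(1))
    hence "B ^\<^sub>m Suc k * S = y \<cdot>\<^sub>m (B ^\<^sub>m k * S) - B ^\<^sub>m k"
      using B S by (simp add: assoc_mult_mat[of _ n n] mult_minus_distrib_mat[of _ n n _ n]
          mult_smult_distrib[of _ n n _ n])
    thus ?thesis
      using B S i j by simp
  qed
  \<comment> \<open>When the two recursions are subtracted, the inhomogeneous terms cancel by
    \<open>pow\<close>.\<close>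
  have diff: "(A ^\<^sub>m k * R) $$ (i, j) - (A' ^\<^sub>m k * R') $$ (i, j) = y ^ k * (R $$ (i, j) - R' $$ (i, j))" for k
  proof (induction k)
    case 0
    then show ?case using A A' R R' by simp
  next
    case (Suc k)
    then show ?case
      unfolding step[OF A R inv(1)] step[OF A' R' inv(2)] pow power_Suc mult.assoc Suc[symmetric]
      by (simp only: right_diff_distrib)
  qed
  have bound: "\<bar>(B ^\<^sub>m k * S) $$ (i, j)\<bar> \<le> (\<Sum>l = 0..<n. \<bar>S $$ (l, j)\<bar>) * real n ^ k"
    if B: "B \<in> carrier_mat n n" and S: "S \<in> carrier_mat n n"
      and Ble: "\<And>i j. i < n \<Longrightarrow> j < n \<Longrightarrow> \<bar>B $$ (i, j)\<bar> \<le> 1" for B S :: "real mat" and k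
  proof -
    have "(B ^\<^sub>m k * S) $$ (i, j) = (\<Sum>l = 0..<n. (B ^\<^sub>m k) $$ (i, l) * S $$ (l, j))"
      using B S i j by (simp add: scalar_prod_def)
    also have "\<bar>\<dots>\<bar> \<le> (\<Sum>l = 0..<n. \<bar>(B ^\<^sub>m k) $$ (i, l) * S $$ (l, j)\<bar>)"
      by (rule sum_abs)
    also have "\<dots> \<le> (\<Sum>l = 0..<n. real n ^ k * \<bar>S $$ (l, j)\<bar>)"
      unfolding abs_mult using abs_pow_mat_index_le[OF B Ble] i
      by (intro sum_mono mult_right_mono) auto
    finally show ?thesis
      by (simp add: sum_distrib_left mult.commute)
  qed
  have "R $$ (i, j) - R' $$ (i, j) = 0"
  proof (rule zero_if_power_growth_exceeded[OF _ _ y])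
    fix k
    have "\<bar>y\<bar> ^ k * \<bar>R $$ (i, j) - R' $$ (i, j)\<bar> = \<bar>(A ^\<^sub>m k * R) $$ (i, j) - (A' ^\<^sub>m k * R') $$ (i, j)\<bar>"
      unfolding diff by (simp add: abs_mult power_abs)
    also have "\<dots> \<le> \<bar>(A ^\<^sub>m k * R) $$ (i, j)\<bar> + \<bar>(A' ^\<^sub>m k * R') $$ (i, j)\<bar>"
      by (rule abs_triangle_ineq4)
    also have "\<dots> \<le> (\<Sum>l = 0..<n. \<bar>R $$ (l, j)\<bar>) * real n ^ k + (\<Sum>l = 0..<n. \<bar>R' $$ (l, j)\<bar>) * real n ^ k"
      by (intro add_mono bound A A' R R' le le')
    finally show "\<bar>y\<bar> ^ k * \<bar>R $$ (i, j) - R' $$ (i, j)\<bar>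
        \<le> ((\<Sum>l = 0..<n. \<bar>R $$ (l, j)\<bar>) + (\<Sum>l = 0..<n. \<bar>R' $$ (l, j)\<bar>)) * real n ^ k"
      by (simp add: algebra_simps)
  qed simp
  thus ?thesis by simp
qed

lemma ex_right_inverse_mat:
  fixes W :: "'a :: field mat"
  assumes W: "W \<in> carrier_mat n n" and "det W \<noteq> 0"
  obtains R where "R \<in> carrier_mat n n" "W * R = 1\<^sub>m n"
  using det_non_zero_imp_unit[OF assms, of "()"] unfolding Units_def ring_mat_def by auto

text \<open>The perturbed determinant is \<open>det (y \<cdot>\<^sub>m 1\<^sub>m n - A)\<close>
  times a second factor into which the resolvent enters only through its entries with both indices
  in \<open>K\<close>. The hypotheses make both factors agree for \<open>A\<close> and
  \<open>A'\<close>.\<close>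

lemma det_supported_perturbation_eq:
  fixes A A' C :: "real mat"
  assumes A: "A \<in> carrier_mat n n" and A': "A' \<in> carrier_mat n n"
    and C: "C \<in> carrier_mat n n"
    and le: "\<And>i j. i < n \<Longrightarrow> j < n \<Longrightarrow> \<bar>A $$ (i, j)\<bar> \<le> 1"
    and le': "\<And>i j. i < n \<Longrightarrow> j < n \<Longrightarrow> \<bar>A' $$ (i, j)\<bar> \<le> 1"
    and y: "real n < \<bar>y\<bar>"
    and det_eq: "det (y \<cdot>\<^sub>m 1\<^sub>m n - A) = det (y \<cdot>\<^sub>m 1\<^sub>m n - A')"
    and pow: "\<And>k i j. i \<in> K \<Longrightarrow> j \<in> K \<Longrightarrow> (A ^\<^sub>m k) $$ (i, j) = (A' ^\<^sub>m k) $$ (i, j)"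
    and supp: "\<And>i j. i < n \<Longrightarrow> j < n \<Longrightarrow> C $$ (i, j) \<noteq> 0 \<Longrightarrow> i \<in> K \<and> j \<in> K"
  shows "det (y \<cdot>\<^sub>m 1\<^sub>m n - A + C) = det (y \<cdot>\<^sub>m 1\<^sub>m n - A' + C)"
proof -
  \<comment> \<open>\<open>E\<close> is the coordinate projection onto \<open>K\<close>. As
    \<open>E * C = C\<close>, it can be inserted between the resolvent and \<open>C\<close>; after
    the factors are commuted it cuts off the columns of the resolvent outside
    \<open>K\<close>.\<close>
  define E :: "real mat" where "E = mat n n (\<lambda>(i, j). if i = j \<and> i \<in> K then 1 else 0)"
  have E: "E \<in> carrier_mat n n" by (simp add: E_def)
  have EC: "E * C = C"
  proof (rule eq_matI)
    fix i j assume ij: "i < dim_row C" "j < dim_col C"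
    have "(E * C) $$ (i, j) = (\<Sum>l = 0..<n. E $$ (i, l) * C $$ (l, j))"
      using ij C E by (simp add: scalar_prod_def)
    also have "\<dots> = (\<Sum>l = 0..<n. if l = i then C $$ (i, j) else 0)"
      using ij C supp[of i j] by (intro sum.cong) (auto simp: E_def)
    finally show "(E * C) $$ (i, j) = C $$ (i, j)"
      using ij C by simp
  qed (use C E in auto)
  have factor: "det (y \<cdot>\<^sub>m 1\<^sub>m n - B + C) = det (y \<cdot>\<^sub>m 1\<^sub>m n - B) * det (1\<^sub>m n + C * (S * E))"
    if B: "B \<in> carrier_mat n n" and S: "S \<in> carrier_mat n n"
      and BS: "(y \<cdot>\<^sub>m 1\<^sub>m n - B) * S = 1\<^sub>m n" for B S :: "real mat"
  proof -
    let ?W = "y \<cdot>\<^sub>m 1\<^sub>m n - B"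
    have W: "?W \<in> carrier_mat n n" using B by auto
    have "?W * (S * C) = C"
      using BS W S C by (simp add: assoc_mult_mat[of _ n n, symmetric])
    hence "?W + C = ?W * (1\<^sub>m n + S * C)"
      using mult_add_distrib_mat[OF W one_carrier_mat mult_carrier_mat[OF S C]]
        right_mult_one_mat[OF W] by simp
    hence "det (?W + C) = det ?W * det (1\<^sub>m n + S * C)"
      using W S C by (simp add: det_mult[of _ n])
    also have "S * C = S * E * C"
      using EC S E C by (simp add: assoc_mult_mat[of _ n n])
    also have "det (1\<^sub>m n + S * E * C) = det (1\<^sub>m n + C * (S * E))"
      using S E C by (intro det_one_plus_mult_commute) auto
    finally show ?thesis .
  qed
  have W: "y \<cdot>\<^sub>m 1\<^sub>m n - A \<in> carrier_mat n n" "y \<cdot>\<^sub>m 1\<^sub>m n - A' \<in> carrier_mat n n"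
    using A A' by auto
  obtain R where R: "R \<in> carrier_mat n n" "(y \<cdot>\<^sub>m 1\<^sub>m n - A) * R = 1\<^sub>m n"
    using ex_right_inverse_mat[OF W(1) det_resolvent_nonzero[OF A le y]] by blast
  obtain R' where R': "R' \<in> carrier_mat n n" "(y \<cdot>\<^sub>m 1\<^sub>m n - A') * R' = 1\<^sub>m n"
    using ex_right_inverse_mat[OF W(2) det_resolvent_nonzero[OF A' le' y]] by blast
  have RE: "(S * E) $$ (l, j) = (if j \<in> K then S $$ (l, j) else 0)"
    if "S \<in> carrier_mat n n" "l < n" "j < n" for S :: "real mat" and l j
  proof -
    have "(S * E) $$ (l, j) = (\<Sum>m = 0..<n. S $$ (l, m) * E $$ (m, j))"
      using that E by (simp add: scalar_prod_def)
    also have "\<dots> = (\<Sum>m = 0..<n. if m = j then (if j \<in> K then S $$ (l, j) else 0) else 0)"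
      using that by (intro sum.cong) (auto simp: E_def)
    finally show ?thesis using that by simp
  qed
  have "C * (R * E) = C * (R' * E)"
  proof (rule eq_matI)
    fix i j assume "i < dim_row (C * (R' * E))" "j < dim_col (C * (R' * E))"
    hence ij: "i < n" "j < n" using C E by auto
    \<comment> \<open>Both products vanish unless \<open>l\<close> and \<open>j\<close> lie in
      \<open>K\<close>: the support of \<open>C\<close> restricts \<open>l\<close>, and the
      projection restricts \<open>j\<close>.\<close>
    have "C $$ (i, l) * (R * E) $$ (l, j) = C $$ (i, l) * (R' * E) $$ (l, j)" if l: "l < n" for l
    proof (cases "C $$ (i, l) = 0 \<or> j \<notin> K")
      case True
      then show ?thesis using RE R R' l ij by auto
    next
      case False
      hence "l \<in> K" "j \<in> K" using supp ij l by auto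
      hence "R $$ (l, j) = R' $$ (l, j)"
        by (intro resolvent_index_eq[OF A A' R(1) R'(1) R(2) R'(2) le le' y]) (use l ij pow in auto)
      then show ?thesis using RE R R' l ij by simp
    qed
    hence sum_eq: "(\<Sum>l = 0..<n. C $$ (i, l) * (R * E) $$ (l, j)) = (\<Sum>l = 0..<n. C $$ (i, l) * (R' * E) $$ (l, j))"
      by (intro sum.cong) auto
    have idx: "(C * (S * E)) $$ (i, j) = (\<Sum>l = 0..<n. C $$ (i, l) * (S * E) $$ (l, j))"
      if "S \<in> carrier_mat n n" for S
      using that ij C E by (simp add: scalar_prod_def)
    show "(C * (R * E)) $$ (i, j) = (C * (R' * E)) $$ (i, j)"
      by (simp only: idx[OF R(1)] idx[OF R'(1)] sum_eq)
  qed (use C E in auto)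
  thus ?thesis
    using factor[OF A R] factor[OF A' R'] det_eq by simp
qed

text \<open>Changing the enumeration applies one permutation to the rows and to the columns, so its
  sign enters squared. The ring is general because the lemma is later applied to matrices of
  polynomials.\<close>

lemma det_enumeration_independent:
  fixes f :: "'v \<Rightarrow> 'v \<Rightarrow> 'a :: comm_ring_1"
  assumes "distinct vs" "distinct ws" "set vs = set ws"
  shows "det (mat (length vs) (length vs) (\<lambda>(i, j). f (vs ! i) (vs ! j)))
    = det (mat (length ws) (length ws) (\<lambda>(i, j). f (ws ! i) (ws ! j)))"
proof -
  define n where "n = length vs"
  have len: "length ws = n"
    using assms by (metis n_def distinct_card)
  obtain p where p: "p permutes {..<n}" and ws: "permute_list p vs = ws"
    using assms by (metis mset_eq_permutation n_def set_eq_iff_mset_eq_distinct)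
  have p': "p permutes {0..<n}" using p by (simp add: lessThan_atLeast0)
  have nth: "ws ! i = vs ! p i" if "i < n" for i
    using that ws p by (auto simp: permute_list_nth n_def)
  have less: "p i < n" if "i < n" for i
    using permutes_in_image[OF p, of i] that by simp
  define A where "A = mat n n (\<lambda>(i, j). f (vs ! i) (vs ! j))"
  define B where "B = mat n n (\<lambda>(i, j). A $$ (p i, j))"
  have A: "A \<in> carrier_mat n n" and B: "B \<in> carrier_mat n n" by (auto simp: A_def B_def)
  \<comment> \<open>Columns of \<open>B\<close> are permuted as rows of its transpose, so that the
    row rule for determinants serves twice.\<close>
  define C where "C = mat n n (\<lambda>(i, j). transpose_mat B $$ (p i, j))"
  have "mat n n (\<lambda>(i, j). f (ws ! i) (ws ! j)) = transpose_mat C"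
    by (intro eq_matI) (auto simp: C_def B_def A_def nth less)
  hence "det (mat n n (\<lambda>(i, j). f (ws ! i) (ws ! j))) = det C"
    using det_transpose[of C n] by (simp add: C_def)
  also have "\<dots> = signof p * det B"
    unfolding C_def using det_permute_rows[OF _ p', of "transpose_mat B"] det_transpose[OF B] B by simp
  also have "\<dots> = signof p * signof p * det A"
    unfolding B_def using det_permute_rows[OF A p'] by (simp add: mult.assoc)
  also have "\<dots> = det A"
    by (cases p rule: sign_cases) auto
  finally show ?thesis
    by (simp add: A_def len flip: n_def)
qed


section \<open>Walk counts, powers of the adjacency matrix, and degrees\<close>

lemma out_degree_with_proj: "out_degree (with_proj G) u = card {w. (u, w) \<in> parcs G}"
proof -
  have "out_arcs (with_proj G) u = Pair u ` {w. (u, w) \<in> parcs G}"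
    by (auto simp: out_arcs_def)
  thus ?thesis
    by (simp add: out_degree_def card_image inj_on_def)
qed

lemma num_walks_0: "u \<in> pverts G \<Longrightarrow> num_walks G 0 u v = (if u = v then 1 else 0)"
proof -
  assume "u \<in> pverts G"
  hence "{p. pre_digraph.awalk (with_proj G) u p v \<and> length p = 0} = (if u = v then {[]} else {})"
    by (auto simp: pre_digraph.awalk_def cas_with_proj_eq)
  thus ?thesis by (simp add: num_walks_def)
qed

lemma pcas_append_iff: "pcas u (p @ [e]) v \<longleftrightarrow> pcas u p (fst e) \<and> snd e = v"
  by (induction p arbitrary: u) auto

text \<open>Walks are sorted by their last arc. Splitting at the end rather than at the start
  matches the recursion \<open>A ^\<^sub>m Suc k = A ^\<^sub>m k * A\<close> for matrix
  powers.\<close>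

lemma num_walks_Suc:
  assumes "pair_fin_digraph G"
  shows "num_walks G (Suc k) u v
    = (\<Sum>w \<in> pverts G. num_walks G k u w * (if (w, v) \<in> parcs G then 1 else 0))"
proof -
  interpret pair_fin_digraph G by fact
  let ?W = "\<lambda>k v. {p. pre_digraph.awalk (with_proj G) u p v \<and> length p = k}"
  have fin: "finite (?W k v)" for k v
    by (rule finite_subset[OF _ finite_lists_length_eq[OF pair_finite_arcs, of k]])
      (auto simp: pre_digraph.awalk_def)
  have "?W (Suc k) v = (\<Union>w \<in> {w \<in> pverts G. (w, v) \<in> parcs G}. (\<lambda>p. p @ [(w, v)]) ` ?W k w)"
    (is "_ = ?R")
  proof (intro equalityI subsetI)
    fix q assume "q \<in> ?W (Suc k) v"
    then obtain p w x where q: "q = p @ [(w, x)]" "length p = k"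
        "pre_digraph.awalk (with_proj G) u (p @ [(w, x)]) v"
      by (auto simp: length_Suc_conv_rev)
    hence "x = v" "(w, x) \<in> parcs G" "p \<in> ?W k w"
      by (auto simp: pre_digraph.awalk_def cas_with_proj_eq pcas_append_iff)
    thus "q \<in> ?R"
      using q(1) in_arcsD1[of w x] by blast
  next
    fix q assume "q \<in> ?R"
    thus "q \<in> ?W (Suc k) v"
      by (auto simp: pre_digraph.awalk_def cas_with_proj_eq pcas_append_iff)
  qed
  hence "num_walks G (Suc k) u v
      = card (\<Union>w \<in> {w \<in> pverts G. (w, v) \<in> parcs G}. (\<lambda>p. p @ [(w, v)]) ` ?W k w)"
    by (simp add: num_walks_def)
  also have "\<dots> = (\<Sum>w \<in> {w \<in> pverts G. (w, v) \<in> parcs G}. card ((\<lambda>p. p @ [(w, v)]) ` ?W k w))"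
    by (rule card_UN_disjoint) (use fin pair_finite_verts in auto)
  also have "\<dots> = (\<Sum>w \<in> {w \<in> pverts G. (w, v) \<in> parcs G}. num_walks G k u w)"
    by (simp add: card_image inj_on_def num_walks_def)
  also have "\<dots> = (\<Sum>w \<in> pverts G. num_walks G k u w * (if (w, v) \<in> parcs G then 1 else 0))"
    using pair_finite_verts by (intro sum.mono_neutral_cong_left) auto
  finally show ?thesis .
qed

text \<open>This is the bridge by which 1-walk regularity becomes a statement about entries of
  matrix powers.\<close>

lemma pow_adjacency_matrix_index:
  assumes G: "pair_fin_digraph G" and vs: "vertex_enum G vs"
    and "i < length vs" "j < length vs"
  shows "(adjacency_matrix vs G ^\<^sub>m k) $$ (i, j) = real (num_walks G k (vs ! i) (vs ! j))"
  using \<open>i < length vs\<close> \<open>j < length vs\<close>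
proof (induction k arbitrary: j)
  case 0
  have "vs ! i \<in> pverts G" using vs 0 nth_mem[of i vs] by (simp add: vertex_enum_def)
  then show ?case
    using 0 vs by (simp add: num_walks_0 adjacency_matrix_def vertex_enum_def nth_eq_iff_index_eq)
next
  case (Suc k)
  let ?n = "length vs" and ?A = "adjacency_matrix vs G"
  have A: "?A \<in> carrier_mat ?n ?n" by (simp add: adjacency_matrix_def)
  have bij: "bij_betw ((!) vs) {0..<?n} (pverts G)"
    using vs bij_betw_nth[of vs "{0..<?n}" "pverts G"]
    by (auto simp: vertex_enum_def lessThan_atLeast0)
  have "(?A ^\<^sub>m Suc k) $$ (i, j) = (\<Sum>l = 0..<?n. (?A ^\<^sub>m k) $$ (i, l) * ?A $$ (l, j))"
    using A Suc.prems by (simp add: scalar_prod_def)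
  also have "\<dots> = (\<Sum>l = 0..<?n. real (num_walks G k (vs ! i) (vs ! l))
      * (if (vs ! l, vs ! j) \<in> parcs G then 1 else 0))"
    using Suc by (intro sum.cong) (auto simp: adjacency_matrix_def)
  also have "\<dots> = (\<Sum>w \<in> pverts G. real (num_walks G k (vs ! i) w)
      * (if (w, vs ! j) \<in> parcs G then 1 else 0))"
    by (rule sum.reindex_bij_betw[OF bij])
  also have "\<dots> = real (num_walks G (Suc k) (vs ! i) (vs ! j))"
    by (simp add: num_walks_Suc[OF G] if_distrib cong: if_cong)
  finally show ?case .
qed

text \<open>A closed walk of length 2 runs along an arc and back along the reverse arc, which exists
  by symmetry.\<close>

lemma out_degree_eq_num_walks_2:
  assumes "pair_graph G" and u: "u \<in> pverts G"
  shows "out_degree (with_proj G) u = num_walks G 2 u u"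
proof -
  interpret pair_graph G by fact
  have fin: "pair_fin_digraph G" by unfold_locales
  have sym: "(w, u) \<in> parcs G \<longleftrightarrow> (u, w) \<in> parcs G" for w
    using pair_sym_arcs by (auto simp: symmetric_def dest: symD)
  have one: "num_walks G 1 u w = (if (u, w) \<in> parcs G then 1 else 0)" for w
  proof -
    have "num_walks G 1 u w = (\<Sum>v \<in> pverts G. num_walks G 0 u v * (if (v, w) \<in> parcs G then 1 else 0))"
      using num_walks_Suc[OF fin, of 0 u w] by simp
    also have "\<dots> = (\<Sum>v \<in> pverts G. if u = v then (if (u, w) \<in> parcs G then 1 else 0) else 0)"
      using u by (intro sum.cong) (auto simp: num_walks_0)
    finally show ?thesis using u pair_finite_verts by simp
  qed
  have "num_walks G 2 u u = (\<Sum>w \<in> pverts G. if (u, w) \<in> parcs G then 1 else 0)"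
    unfolding num_walks_Suc[OF fin, of 1 u u, simplified Suc_1]
    by (intro sum.cong) (use one sym in auto)
  also have "\<dots> = card {w \<in> pverts G. (u, w) \<in> parcs G}"
    using pair_finite_verts by (simp flip: sum.inter_filter)
  also have "{w \<in> pverts G. (u, w) \<in> parcs G} = {w. (u, w) \<in> parcs G}"
    by (auto dest: in_arcsD2)
  finally show ?thesis by (simp add: out_degree_with_proj)
qed

text \<open>The number of closed walks of length 2 is the degree. On an empty vertex set any
  \<open>d\<close> will do.\<close>

lemma one_walk_regular_imp_regular:
  assumes "pair_graph X" "one_walk_regular X"
  obtains d where "\<And>u. u \<in> pverts X \<Longrightarrow> out_degree (with_proj X) u = d"
proof (cases "pverts X = {}")
  case False
  then obtain u0 where "u0 \<in> pverts X" by blast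
  hence "out_degree (with_proj X) u = num_walks X 2 u0 u0" if "u \<in> pverts X" for u
    using that assms unfolding one_walk_regular_def
    by (metis out_degree_eq_num_walks_2 one_le_numeral)
  then show ?thesis by (rule that)
qed (use that in blast)

text \<open>Inside a clique two vertices are equal or adjacent, which are exactly the two cases that
  1-walk regularity controls. Length 0 lies outside that definition and is settled by injectivity of
  \<open>\<pi>\<close>.\<close>

lemma num_walks_clique_eq:
  assumes "one_walk_regular X" and K: "is_clique X K" and piK: "is_clique X (\<pi> ` K)"
    and inj: "inj_on \<pi> K" and u: "u \<in> K" and v: "v \<in> K"
  shows "num_walks X k u v = num_walks X k (\<pi> u) (\<pi> v)"
proof (cases "k = 0")
  case True
  have "u \<in> pverts X" "\<pi> u \<in> pverts X"
    using K piK u by (auto simp: is_clique_def)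
  then show ?thesis
    using True inj u v by (auto simp: num_walks_0 inj_on_eq_iff)
next
  case False
  hence k: "k \<ge> 1" by simp
  show ?thesis
  proof (cases "u = v")
    case True
    moreover have "u \<in> pverts X" "\<pi> u \<in> pverts X"
      using K piK u by (auto simp: is_clique_def)
    ultimately show ?thesis
      using assms(1) k unfolding one_walk_regular_def by blast
  next
    case False
    hence "(u, v) \<in> parcs X" "(\<pi> u, \<pi> v) \<in> parcs X"
      using K piK u v inj by (auto simp: is_clique_def inj_on_eq_iff)
    then show ?thesis
      using assms(1) k unfolding one_walk_regular_def by blast
  qed
qed

section \<open>Characteristic polynomials of the four graph matrices\<close>

lemma char_poly_enumeration_independent:
  fixes f :: "'v \<Rightarrow> 'v \<Rightarrow> 'a :: comm_ring_1"
  assumes "distinct vs" "distinct ws" "set vs = set ws"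
  shows "char_poly (mat (length vs) (length vs) (\<lambda>(i, j). f (vs ! i) (vs ! j)))
    = char_poly (mat (length ws) (length ws) (\<lambda>(i, j). f (ws ! i) (ws ! j)))"
proof -
  \<comment> \<open>As the enumeration is distinct, \<open>i = j\<close> can be tested on vertices.
    So the entries of the characteristic matrix are again a function of two vertices, and the
    determinant lemma applies.\<close>
  define h where "h u v = (if u = v then [:0, 1:] else 0) + [:- f u v:]" for u v
  have cpm: "char_poly_matrix (mat (length us) (length us) (\<lambda>(i, j). f (us ! i) (us ! j)))
      = mat (length us) (length us) (\<lambda>(i, j). h (us ! i) (us ! j))"
    if "distinct us" for us
    using that by (intro eq_matI) (auto simp: char_poly_matrix_def nth_eq_iff_index_eq h_def)
  show ?thesis
    unfolding char_poly_def cpm[OF assms(1)] cpm[OF assms(2)]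
    by (rule det_enumeration_independent[OF assms])
qed

lemma diag_mult_mult_diag:
  fixes P :: "'a :: semiring_1 mat"
  assumes P: "P \<in> carrier_mat n n"
  shows "mat n n (\<lambda>(i, j). if i = j then s i else 0) * P * mat n n (\<lambda>(i, j). if i = j then t i else 0)
    = mat n n (\<lambda>(i, j). s i * P $$ (i, j) * t j)"
proof (rule eq_matI)
  fix i j assume "i < dim_row (mat n n (\<lambda>(i, j). s i * P $$ (i, j) * t j))"
    "j < dim_col (mat n n (\<lambda>(i, j). s i * P $$ (i, j) * t j))"
  hence ij: "i < n" "j < n" by auto
  let ?S = "mat n n (\<lambda>(i, j). if i = j then s i else 0)"
  let ?T = "mat n n (\<lambda>(i, j). if i = j then t i else 0)"
  have SP: "(?S * P) $$ (i, l) = s i * P $$ (i, l)" if "l < n" for l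
  proof -
    have "(?S * P) $$ (i, l) = (\<Sum>m = 0..<n. ?S $$ (i, m) * P $$ (m, l))"
      using ij that P by (simp add: scalar_prod_def)
    also have "\<dots> = (\<Sum>m = 0..<n. if m = i then s i * P $$ (i, l) else 0)"
      using ij by (intro sum.cong) auto
    finally show ?thesis using ij by simp
  qed
  have "(?S * P * ?T) $$ (i, j) = (\<Sum>l = 0..<n. (?S * P) $$ (i, l) * ?T $$ (l, j))"
    using ij P by (simp add: scalar_prod_def)
  also have "\<dots> = (\<Sum>l = 0..<n. if l = j then s i * P $$ (i, j) * t j else 0)"
    using ij SP by (intro sum.cong) auto
  finally show "(?S * P * ?T) $$ (i, j) = mat n n (\<lambda>(i, j). s i * P $$ (i, j) * t j) $$ (i, j)"
    using ij by simp
qed (use P in auto)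

lemma graph_matrices_carrier:
  "adjacency_matrix vs G \<in> carrier_mat (length vs) (length vs)"
  "laplacian_matrix vs G \<in> carrier_mat (length vs) (length vs)"
  "unsigned_laplacian_matrix vs G \<in> carrier_mat (length vs) (length vs)"
  "normalized_laplacian_matrix vs G \<in> carrier_mat (length vs) (length vs)"
  by (rule carrier_matI; simp add: adjacency_matrix_def degree_matrix_def laplacian_matrix_def
      unsigned_laplacian_matrix_def normalized_laplacian_matrix_def inv_sqrt_degree_matrix_def)+

lemma normalized_laplacian_matrix_eq:
  "normalized_laplacian_matrix vs G = mat (length vs) (length vs) (\<lambda>(i, j).
     1 / sqrt (real (out_degree (with_proj G) (vs ! i))) * laplacian_matrix vs G $$ (i, j)
     * (1 / sqrt (real (out_degree (with_proj G) (vs ! j)))))"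
  unfolding normalized_laplacian_matrix_def inv_sqrt_degree_matrix_def
  by (rule diag_mult_mult_diag) (rule graph_matrices_carrier)

text \<open>In each of the four matrices an entry depends only on its two vertices. This is used to
  equate \<open>det (y \<cdot>\<^sub>m 1\<^sub>m n - A)\<close> for two enumerations of
  \<open>X\<close>, and to pass to the arbitrary enumerations in \<open>cospectral\<close>.\<close>

lemma char_poly_graph_matrices_enumeration_independent:
  assumes vs: "vertex_enum G vs" and ws: "vertex_enum G ws"
  shows "char_poly (adjacency_matrix vs G) = char_poly (adjacency_matrix ws G)"
    and "char_poly (laplacian_matrix vs G) = char_poly (laplacian_matrix ws G)"
    and "char_poly (unsigned_laplacian_matrix vs G) = char_poly (unsigned_laplacian_matrix ws G)"
    and "char_poly (normalized_laplacian_matrix vs G) = char_poly (normalized_laplacian_matrix ws G)"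
proof -
  let ?a = "\<lambda>u v. if (u, v) \<in> parcs G then 1 else 0 :: real"
  let ?d = "\<lambda>u. real (out_degree (with_proj G) u)"
  let ?D = "\<lambda>u v. if u = v then ?d u else 0"
  let ?mat = "\<lambda>f us. mat (length us) (length us) (\<lambda>(i, j). f (us ! i) (us ! j) :: real)"
  have indep: "char_poly (?mat f vs) = char_poly (?mat f ws)" for f
    using vs ws by (intro char_poly_enumeration_independent) (auto simp: vertex_enum_def)
  have adj: "adjacency_matrix us G = ?mat ?a us" for us
    by (simp add: adjacency_matrix_def)
  have lap: "laplacian_matrix us G = ?mat (\<lambda>u v. ?D u v - ?a u v) us"
    and ulap: "unsigned_laplacian_matrix us G = ?mat (\<lambda>u v. ?D u v + ?a u v) us"
    if "vertex_enum G us" for us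
    using that
    by (auto simp: laplacian_matrix_def unsigned_laplacian_matrix_def adjacency_matrix_def
        degree_matrix_def vertex_enum_def nth_eq_iff_index_eq intro!: eq_matI)
  have nlap: "normalized_laplacian_matrix us G
      = ?mat (\<lambda>u v. 1 / sqrt (?d u) * (?D u v - ?a u v) * (1 / sqrt (?d v))) us"
    if "vertex_enum G us" for us
    unfolding normalized_laplacian_matrix_eq lap[OF that] by (intro eq_matI) auto
  show "char_poly (adjacency_matrix vs G) = char_poly (adjacency_matrix ws G)"
    unfolding adj by (rule indep)
  show "char_poly (laplacian_matrix vs G) = char_poly (laplacian_matrix ws G)"
    unfolding lap[OF vs] lap[OF ws] by (rule indep)
  show "char_poly (unsigned_laplacian_matrix vs G) = char_poly (unsigned_laplacian_matrix ws G)"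
    unfolding ulap[OF vs] ulap[OF ws] by (rule indep)
  show "char_poly (normalized_laplacian_matrix vs G) = char_poly (normalized_laplacian_matrix ws G)"
    unfolding nlap[OF vs] nlap[OF ws] by (rule indep)
qed

lemma poly_char_poly_eq_det:
  fixes M :: "'a :: field mat"
  assumes "M \<in> carrier_mat n n"
  shows "poly (char_poly M) x = det (x \<cdot>\<^sub>m 1\<^sub>m n - M)"
proof -
  have "- char_matrix M x = x \<cdot>\<^sub>m 1\<^sub>m n - M"
    using assms by (intro eq_matI) (auto simp: char_matrix_def)
  thus ?thesis by (simp add: char_poly_matrix[OF assms])
qed

text \<open>The row and the column of the Laplacian at an isolated vertex vanish, so replacing the degree
  \<open>0\<close> by \<open>1\<close> makes the scaling invertible without changing the normalized Laplacian.\<close>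

lemma poly_char_poly_graph_matrices:
  fixes A :: "real mat" and b :: "nat \<Rightarrow> nat \<Rightarrow> real" and d x :: real
  assumes n: "length zs = n" and A: "A \<in> carrier_mat n n"
    and adj: "adjacency_matrix zs Z = A - mat n n (\<lambda>(i, j). b i j)"
    and deg_all: "\<forall>i<n. real (out_degree (with_proj Z) (zs ! i)) = g i"
    and arcs: "finite (parcs Z)" "sym (parcs Z)"
  defines "d' \<equiv> if d = 0 then 1 else d" and "g' \<equiv> \<lambda>i. if g i = 0 then 1 else g i"
  shows "poly (char_poly (adjacency_matrix zs Z)) x
      = det (x \<cdot>\<^sub>m 1\<^sub>m n - A + mat n n (\<lambda>(i, j). b i j))"
    and "poly (char_poly (laplacian_matrix zs Z)) x
      = (- 1) ^ n * det ((d - x) \<cdot>\<^sub>m 1\<^sub>m n - A + mat n n (\<lambda>(i, j). b i j + (if i = j then g i - d else 0)))"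
    and "poly (char_poly (unsigned_laplacian_matrix zs Z)) x
      = det ((x - d) \<cdot>\<^sub>m 1\<^sub>m n - A + mat n n (\<lambda>(i, j). b i j - (if i = j then g i - d else 0)))"
    and "poly (char_poly (normalized_laplacian_matrix zs Z)) x
      = (det (mat n n (\<lambda>(i, j). if i = j then 1 / sqrt (g' i) else 0)))\<^sup>2
        * ((- 1) ^ n * det ((d - x * d') \<cdot>\<^sub>m 1\<^sub>m n - A
            + mat n n (\<lambda>(i, j). b i j + (if i = j then g i - d - x * (g' i - d') else 0))))"
proof -
  let ?I = "1\<^sub>m n :: real mat"
  have deg: "real (out_degree (with_proj Z) (zs ! i)) = g i" if "i < n" for i
    using deg_all that by blast
  have adj_idx: "adjacency_matrix zs Z $$ (i, j) = A $$ (i, j) - b i j" if "i < n" "j < n" for i j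
    using that A by (simp add: adj)
  have D: "degree_matrix zs Z = mat n n (\<lambda>(i, j). if i = j then g i else 0)"
    using deg by (intro eq_matI) (auto simp: degree_matrix_def n)
  have carr: "adjacency_matrix zs Z \<in> carrier_mat n n" "laplacian_matrix zs Z \<in> carrier_mat n n"
    "unsigned_laplacian_matrix zs Z \<in> carrier_mat n n" "normalized_laplacian_matrix zs Z \<in> carrier_mat n n"
    using graph_matrices_carrier[of zs Z] by (simp_all add: n)
  have det_neg: "(- 1) ^ n * det M = det (- 1 \<cdot>\<^sub>m M)" if "M \<in> carrier_mat n n" for M :: "real mat"
    using that by simp
  show "poly (char_poly (adjacency_matrix zs Z)) x = det (x \<cdot>\<^sub>m ?I - A + mat n n (\<lambda>(i, j). b i j))"
    unfolding poly_char_poly_eq_det[OF carr(1)]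
    by (rule arg_cong[of _ _ det]) (use A in \<open>auto simp: adj intro!: eq_matI\<close>)
  \<comment> \<open>The degree \<open>g i\<close> is split as \<open>d + (g i - d)\<close>: the
    constant joins the spectral parameter and the excess joins the correction. The sign
    \<open>(- 1) ^ n\<close> comes from negating the matrix so that \<open>A\<close> appears as
    \<open>- A\<close>; the unsigned Laplacian needs no such change.\<close>
  show "poly (char_poly (laplacian_matrix zs Z)) x
      = (- 1) ^ n * det ((d - x) \<cdot>\<^sub>m ?I - A + mat n n (\<lambda>(i, j). b i j + (if i = j then g i - d else 0)))"
    unfolding poly_char_poly_eq_det[OF carr(2)]
    unfolding laplacian_matrix_def adj D
    by (subst det_neg, use A in simp, rule arg_cong[of _ _ det])
      (use A in \<open>auto intro!: eq_matI\<close>)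
  show "poly (char_poly (unsigned_laplacian_matrix zs Z)) x
      = det ((x - d) \<cdot>\<^sub>m ?I - A + mat n n (\<lambda>(i, j). b i j - (if i = j then g i - d else 0)))"
    unfolding poly_char_poly_eq_det[OF carr(3)]
    unfolding unsigned_laplacian_matrix_def adj D
    by (rule arg_cong[of _ _ det]) (use A in \<open>auto intro!: eq_matI\<close>)
  let ?T = "mat n n (\<lambda>(i, j). if i = j then 1 / sqrt (g' i) else 0)"
  let ?W = "(d - x * d') \<cdot>\<^sub>m ?I - A
    + mat n n (\<lambda>(i, j). b i j + (if i = j then g i - d - x * (g' i - d') else 0))"
  have T: "?T \<in> carrier_mat n n" and W: "- 1 \<cdot>\<^sub>m ?W \<in> carrier_mat n n" using A by simp_all
  have L: "laplacian_matrix zs Z $$ (i, j) = (if i = j then g i else 0) - A $$ (i, j) + b i j"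
    if "i < n" "j < n" for i j
    using that A by (simp add: laplacian_matrix_def adj D)
  \<comment> \<open>A vertex of degree 0 has no outgoing arcs, since finiteness excludes the default
    cardinality 0 of an infinite set. By symmetry it has no incoming arcs either.\<close>
  have isolated: "A $$ (i, j) = b i j" "A $$ (j, i) = b j i" if "i < n" "j < n" "g i = 0" for i j
  proof -
    have "finite {w. (zs ! i, w) \<in> parcs Z}"
      by (rule finite_subset[OF _ finite_imageI[OF arcs(1), of snd]]) force
    hence "{w. (zs ! i, w) \<in> parcs Z} = {}"
      using deg[OF that(1)] that(3) by (simp add: out_degree_with_proj)
    hence "(zs ! i, zs ! j) \<notin> parcs Z" "(zs ! j, zs ! i) \<notin> parcs Z"
      using arcs(2) by (auto dest: symD)
    thus "A $$ (i, j) = b i j" "A $$ (j, i) = b j i"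
      using adj_idx[of i j] adj_idx[of j i] that n by (simp_all add: adjacency_matrix_def)
  qed
  have g_nonneg: "g i \<ge> 0" if "i < n" for i
    using deg[OF that] by simp
  \<comment> \<open>The matrix \<open>?W\<close> is the Laplacian minus \<open>x\<close> times the
    diagonal matrix of the \<open>g' i\<close>; scaling by \<open>1 / sqrt (g' i)\<close> on both
    sides turns that diagonal part into \<open>x\<close> times the identity.\<close>
  have "x \<cdot>\<^sub>m ?I - normalized_laplacian_matrix zs Z = ?T * (- 1 \<cdot>\<^sub>m ?W) * ?T"
    unfolding diag_mult_mult_diag[OF W]
  proof (rule eq_matI)
    fix i j assume "i < dim_row (mat n n (\<lambda>(i, j). 1 / sqrt (g' i) * (- 1 \<cdot>\<^sub>m ?W) $$ (i, j) * (1 / sqrt (g' j))))"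
      "j < dim_col (mat n n (\<lambda>(i, j). 1 / sqrt (g' i) * (- 1 \<cdot>\<^sub>m ?W) $$ (i, j) * (1 / sqrt (g' j))))"
    hence ij: "i < n" "j < n" by auto
    have W_idx: "(- 1 \<cdot>\<^sub>m ?W) $$ (i, j)
        = (if i = j then x * g' i - g i else 0) + A $$ (i, j) - b i j"
      using ij A by (auto simp: algebra_simps)
    have N: "normalized_laplacian_matrix zs Z $$ (i, j)
        = 1 / sqrt (g i) * ((if i = j then g i else 0) - A $$ (i, j) + b i j) * (1 / sqrt (g j))"
      using ij n L[OF ij] deg by (simp add: normalized_laplacian_matrix_eq)
    have lhs: "(x \<cdot>\<^sub>m ?I - normalized_laplacian_matrix zs Z) $$ (i, j)
        = (if i = j then x else 0) - normalized_laplacian_matrix zs Z $$ (i, j)"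
      using ij carr(4) by simp
    have rhs: "mat n n (\<lambda>(i, j). 1 / sqrt (g' i) * (- 1 \<cdot>\<^sub>m ?W) $$ (i, j) * (1 / sqrt (g' j))) $$ (i, j)
        = 1 / sqrt (g' i) * ((if i = j then x * g' i - g i else 0) + A $$ (i, j) - b i j) * (1 / sqrt (g' j))"
      unfolding W_idx[symmetric] using ij by (simp only: index_mat(1) prod.case)
    have sq: "sqrt (g' i) * sqrt (g' i) = g' i" "g' i > 0"
      using g_nonneg[OF ij(1)] by (auto simp: g'_def)
    show "(x \<cdot>\<^sub>m ?I - normalized_laplacian_matrix zs Z) $$ (i, j)
        = mat n n (\<lambda>(i, j). 1 / sqrt (g' i) * (- 1 \<cdot>\<^sub>m ?W) $$ (i, j) * (1 / sqrt (g' j))) $$ (i, j)"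
    proof (cases "g i = 0 \<or> g j = 0")
      case True
      hence "A $$ (i, j) = b i j" using isolated ij by blast
      thus ?thesis
        using True sq unfolding lhs N rhs by (auto simp: g'_def)
    next
      case False
      thus ?thesis
        using sq unfolding lhs N rhs by (auto simp: g'_def field_simps)
    qed
  qed (use carr in auto)
  hence "det (x \<cdot>\<^sub>m ?I - normalized_laplacian_matrix zs Z) = det ?T * det (- 1 \<cdot>\<^sub>m ?W) * det ?T"
    using det_mult[OF mult_carrier_mat[OF T W] T] det_mult[OF T W] by simp
  thus "poly (char_poly (normalized_laplacian_matrix zs Z)) x = (det ?T)\<^sup>2 * ((- 1) ^ n * det ?W)"
    using A unfolding poly_char_poly_eq_det[OF carr(4)]
    by (subst det_neg) (simp_all add: power2_eq_square del: det_smult)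
qed


section \<open>Transport of the deleted edges by a bijection of the vertices\<close>

text \<open>The complements of the two images in the finite set \<open>V\<close> have equal size, so
  any bijection between them completes the prescribed part.\<close>

lemma ex_bij_betw_extending:
  assumes V: "finite V" and f: "inj_on f S" "f ` S \<subseteq> V" and g: "inj_on g S" "g ` S \<subseteq> V"
  obtains \<pi> where "bij_betw \<pi> V V" "\<And>a. a \<in> S \<Longrightarrow> \<pi> (f a) = g a"
proof -
  have "card (f ` S) = card (g ` S)"
    using f(1) g(1) by (simp add: card_image)
  hence "card (V - f ` S) = card (V - g ` S)"
    using V f(2) g(2) by (simp add: card_Diff_subset finite_subset)
  then obtain h where h: "bij_betw h (V - f ` S) (V - g ` S)"
    using V finite_same_card_bij[of "V - f ` S" "V - g ` S"] by auto
  define \<pi> where "\<pi> v = (if v \<in> f ` S then g (inv_into S f v) else h v)" for v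
  have ext: "\<pi> (f a) = g a" if "a \<in> S" for a
    using that f(1) by (simp add: \<pi>_def)
  have "bij_betw \<pi> (f ` S) (g ` S)"
    unfolding bij_betw_def
  proof
    show "inj_on \<pi> (f ` S)"
      using ext g(1) by (auto simp: inj_on_def)
    show "\<pi> ` f ` S = g ` S"
      using ext by (simp add: image_image)
  qed
  moreover have "bij_betw \<pi> (V - f ` S) (V - g ` S)"
    using h by (rule bij_betw_cong[THEN iffD1, rotated]) (simp add: \<pi>_def)
  ultimately have "bij_betw \<pi> (f ` S \<union> (V - f ` S)) (g ` S \<union> (V - g ` S))"
    by (rule bij_betw_combine) auto
  moreover have "f ` S \<union> (V - f ` S) = V" "g ` S \<union> (V - g ` S) = V"
    using f(2) g(2) by auto
  ultimately show ?thesis using that ext by metis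
qed

text \<open>A nonzero polynomial has finitely many roots. It therefore suffices to evaluate where
  \<open>x\<close> is so negative that each spectral parameter exceeds \<open>n\<close> in
  modulus.\<close>

lemma poly_eqI_below:
  fixes p q :: "real poly"
  assumes "\<And>x. x < c \<Longrightarrow> poly p x = poly q x"
  shows "p = q"
proof (rule ccontr)
  assume "p \<noteq> q"
  hence "finite {x. poly (p - q) x = 0}"
    by (intro poly_roots_finite) simp
  moreover have "{..<c} \<subseteq> {x. poly (p - q) x = 0}"
    using assms by auto
  ultimately show False
    using infinite_Iio[of c] finite_subset by blast
qed

text \<open>Position \<open>i\<close> stands for \<open>vs ! i\<close> in one enumeration and for
  its image under \<open>\<pi>\<close> in the other, so a single correction \<open>c\<close> on
  positions perturbs both cliques. The block consists of the positions of \<open>K\<close> in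
  \<open>vs\<close>.\<close>

lemma det_adjacency_perturbation_eq:
  assumes X: "pair_graph X" "one_walk_regular X"
    and K: "is_clique X K" "is_clique X (\<pi> ` K)"
    and \<pi>: "bij_betw \<pi> (pverts X) (pverts X)"
    and vs: "vertex_enum X vs" and n: "length vs = n"
    and y: "real n < \<bar>y\<bar>"
    and supp: "\<forall>i<n. \<forall>j<n. c i j \<noteq> 0 \<longrightarrow> vs ! i \<in> K \<and> vs ! j \<in> K"
  shows "det (y \<cdot>\<^sub>m 1\<^sub>m n - adjacency_matrix vs X + mat n n (\<lambda>(i, j). c i j))
    = det (y \<cdot>\<^sub>m 1\<^sub>m n - adjacency_matrix (map \<pi> vs) X + mat n n (\<lambda>(i, j). c i j))"
proof (rule det_supported_perturbation_eq[where K = "{i. i < n \<and> vs ! i \<in> K}"])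
  interpret pair_graph X by fact
  have fin: "pair_fin_digraph X" by unfold_locales
  have inj: "inj_on \<pi> (pverts X)" using \<pi> by (simp add: bij_betw_def)
  have ws: "vertex_enum X (map \<pi> vs)"
    using vs \<pi> by (auto simp: vertex_enum_def distinct_map bij_betw_def)
  show "adjacency_matrix vs X \<in> carrier_mat n n" "adjacency_matrix (map \<pi> vs) X \<in> carrier_mat n n"
    using n by (auto simp: adjacency_matrix_def)
  thus "det (y \<cdot>\<^sub>m 1\<^sub>m n - adjacency_matrix vs X) = det (y \<cdot>\<^sub>m 1\<^sub>m n - adjacency_matrix (map \<pi> vs) X)"
    using char_poly_graph_matrices_enumeration_independent(1)[OF vs ws]
    by (metis poly_char_poly_eq_det)
  fix k i j
  assume "i \<in> {i. i < n \<and> vs ! i \<in> K}" "j \<in> {i. i < n \<and> vs ! i \<in> K}"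
  moreover have "inj_on \<pi> K"
    using inj K(1) by (auto simp: is_clique_def intro: inj_on_subset)
  ultimately show "(adjacency_matrix vs X ^\<^sub>m k) $$ (i, j) = (adjacency_matrix (map \<pi> vs) X ^\<^sub>m k) $$ (i, j)"
    using n num_walks_clique_eq[OF X(2) K]
    by (simp add: pow_adjacency_matrix_index[OF fin vs] pow_adjacency_matrix_index[OF fin ws])
qed (use n y supp in \<open>auto simp: adjacency_matrix_def\<close>)

lemma out_degree_delete_arcs:
  assumes "finite (parcs X)" "D \<subseteq> parcs X"
  shows "out_degree (with_proj \<lparr>pverts = V, parcs = parcs X - D\<rparr>) u
    = out_degree (with_proj X) u - card {w. (u, w) \<in> D}"
proof -
  have "finite {w. (u, w) \<in> D}"
    by (rule finite_subset[OF _ finite_imageI[OF assms(1), of snd]]) (use assms(2) in force)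
  moreover have "{w. (u, w) \<in> parcs X - D} = {w. (u, w) \<in> parcs X} - {w. (u, w) \<in> D}"
    by auto
  ultimately show ?thesis
    unfolding out_degree_with_proj using assms(2) by (simp add: card_Diff_subset subset_iff)
qed

text \<open>Read along \<open>vs\<close> and \<open>map \<pi> vs\<close>, the graphs
  \<open>Z\<close> and \<open>Z'\<close> have the same deleted positions \<open>b\<close> and the
  same degrees \<open>g\<close>. Their evaluated characteristic polynomials thus differ only in the
  enumeration of \<open>X\<close> behind the adjacency matrix.\<close>

lemma delete_arcs_in_cliques_cospectral:
  fixes X :: "'a pair_pre_digraph"
  assumes X: "pair_graph X" "one_walk_regular X"
    and K: "is_clique X K" "is_clique X (\<pi> ` K)"
    and \<pi>: "bij_betw \<pi> (pverts X) (pverts X)"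
    and D: "D \<subseteq> K \<times> K" "D \<subseteq> parcs X" "sym D"
    and D': "D' = map_prod \<pi> \<pi> ` D" "D' \<subseteq> parcs X"
  defines "Z \<equiv> \<lparr>pverts = pverts X, parcs = parcs X - D\<rparr>"
    and "Z' \<equiv> \<lparr>pverts = pverts X, parcs = parcs X - D'\<rparr>"
  shows "cospectral adjacency_matrix Z Z' \<and> cospectral laplacian_matrix Z Z'
    \<and> cospectral unsigned_laplacian_matrix Z Z' \<and> cospectral normalized_laplacian_matrix Z Z'"
proof -
  interpret pair_graph X by fact
  obtain d where d: "\<And>u. u \<in> pverts X \<Longrightarrow> out_degree (with_proj X) u = d"
    using one_walk_regular_imp_regular[OF X] by blast
  have inj: "inj_on \<pi> (pverts X)" using \<pi> by (simp add: bij_betw_def)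
  have KV: "K \<subseteq> pverts X" using K(1) by (simp add: is_clique_def)
  have DV: "D \<subseteq> pverts X \<times> pverts X" using D(1) KV by auto
  have symX: "sym (parcs X)" using pair_sym_arcs by (simp add: symmetric_def)
  have D'_iff: "(\<pi> u, \<pi> v) \<in> D' \<longleftrightarrow> (u, v) \<in> D" if "u \<in> pverts X" "v \<in> pverts X" for u v
  proof
    assume "(\<pi> u, \<pi> v) \<in> D'"
    then obtain a b where ab: "(a, b) \<in> D" "\<pi> u = \<pi> a" "\<pi> v = \<pi> b"
      unfolding D'(1) by auto
    hence "a \<in> pverts X" "b \<in> pverts X" using DV by auto
    hence "u = a" "v = b" using ab inj that by (simp_all add: inj_on_eq_iff)
    thus "(u, v) \<in> D" using ab by simp
  next
    assume "(u, v) \<in> D"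
    thus "(\<pi> u, \<pi> v) \<in> D'" unfolding D'(1) by (rule rev_image_eqI) simp
  qed
  have "sym D'"
    using D(3) unfolding D'(1) by (auto simp: sym_def)
  hence sym: "sym (parcs Z)" "sym (parcs Z')"
    using symX D(3) unfolding Z_def Z'_def by (auto simp: sym_def)
  have fin: "finite (parcs Z)" "finite (parcs Z')"
    using pair_finite_arcs by (auto simp: Z_def Z'_def)
  \<comment> \<open>The map \<open>\<pi>\<close> may fail to be an automorphism of \<open>X\<close>;
    degrees agree because \<open>X\<close> is regular and \<open>\<pi>\<close> carries the arcs
    deleted at \<open>u\<close> to those deleted at \<open>\<pi> u\<close>.\<close>
  have deg': "out_degree (with_proj Z') (\<pi> u) = out_degree (with_proj Z) u" if u: "u \<in> pverts X" for u
  proof -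
    have "{w. (\<pi> u, w) \<in> D'} = \<pi> ` {w. (u, w) \<in> D}"
    proof (intro equalityI subsetI)
      fix w assume w: "w \<in> {w. (\<pi> u, w) \<in> D'}"
      then obtain a where a: "w = \<pi> a" "a \<in> pverts X"
        using DV unfolding D'(1) by auto
      hence "(u, a) \<in> D" using w u D'_iff by simp
      thus "w \<in> \<pi> ` {w. (u, w) \<in> D}" using a(1) by blast
    next
      fix w assume "w \<in> \<pi> ` {w. (u, w) \<in> D}"
      thus "w \<in> {w. (\<pi> u, w) \<in> D'}" using u DV D'_iff by auto
    qed
    moreover have "inj_on \<pi> {w. (u, w) \<in> D}"
      using D(1) KV by (intro inj_on_subset[OF inj]) auto
    moreover have "\<pi> u \<in> pverts X" using u \<pi> by (auto simp: bij_betw_def)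
    ultimately show ?thesis
      unfolding Z_def Z'_def using u d D(2) D'(2) pair_finite_arcs
      by (simp add: out_degree_delete_arcs card_image)
  qed
  \<comment> \<open>No arc is deleted outside \<open>K\<close>, so the diagonal corrections below
    are supported on \<open>K\<close> too.\<close>
  have deg_d: "out_degree (with_proj Z) u = d" if "u \<in> pverts X" "u \<notin> K" for u
  proof -
    have "{w. (u, w) \<in> D} = {}" using that D(1) by auto
    thus ?thesis
      unfolding Z_def using that d D(2) pair_finite_arcs by (simp add: out_degree_delete_arcs)
  qed
  have "char_poly (adjacency_matrix vs Z) = char_poly (adjacency_matrix ws Z')
      \<and> char_poly (laplacian_matrix vs Z) = char_poly (laplacian_matrix ws Z')
      \<and> char_poly (unsigned_laplacian_matrix vs Z) = char_poly (unsigned_laplacian_matrix ws Z')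
      \<and> char_poly (normalized_laplacian_matrix vs Z) = char_poly (normalized_laplacian_matrix ws Z')"
    if "vertex_enum Z vs" and ws: "vertex_enum Z' ws" for vs ws
  proof -
    have vs: "vertex_enum X vs" using that(1) by (simp add: vertex_enum_def Z_def)
    have nth_V: "vs ! i \<in> pverts X" if "i < length vs" for i
      using vs that nth_mem[of i vs] by (simp add: vertex_enum_def)
    have \<pi>vs: "vertex_enum Z' (map \<pi> vs)"
      using vs \<pi> by (auto simp: vertex_enum_def distinct_map bij_betw_def Z'_def)
    define n where "n = length vs"
    define b :: "nat \<Rightarrow> nat \<Rightarrow> real" where "b i j = (if (vs ! i, vs ! j) \<in> D then 1 else 0)" for i j
    define g where "g i = real (out_degree (with_proj Z) (vs ! i))" for i
    have len: "length vs = n" "length (map \<pi> vs) = n" by (simp_all add: n_def)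
    have carr: "adjacency_matrix vs X \<in> carrier_mat n n" "adjacency_matrix (map \<pi> vs) X \<in> carrier_mat n n"
      by (simp_all add: adjacency_matrix_def n_def)
    have adj: "adjacency_matrix vs Z = adjacency_matrix vs X - mat n n (\<lambda>(i, j). b i j)"
      using D(2) by (intro eq_matI) (auto simp: adjacency_matrix_def b_def Z_def n_def)
    have adj': "adjacency_matrix (map \<pi> vs) Z' = adjacency_matrix (map \<pi> vs) X - mat n n (\<lambda>(i, j). b i j)"
    proof (rule eq_matI)
      fix i j
      assume "i < dim_row (adjacency_matrix (map \<pi> vs) X - mat n n (\<lambda>(i, j). b i j))"
        "j < dim_col (adjacency_matrix (map \<pi> vs) X - mat n n (\<lambda>(i, j). b i j))"
      hence ij: "i < length vs" "j < length vs" by (auto simp: n_def)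
      have "(\<pi> (vs ! i), \<pi> (vs ! j)) \<in> D' \<longleftrightarrow> (vs ! i, vs ! j) \<in> D"
        using ij by (intro D'_iff nth_V)
      thus "adjacency_matrix (map \<pi> vs) Z' $$ (i, j)
          = (adjacency_matrix (map \<pi> vs) X - mat n n (\<lambda>(i, j). b i j)) $$ (i, j)"
        using ij D'(2) by (auto simp: adjacency_matrix_def b_def Z'_def n_def)
    qed (auto simp: adjacency_matrix_def n_def)
    have g: "\<forall>i<n. real (out_degree (with_proj Z) (vs ! i)) = g i"
      "\<forall>i<n. real (out_degree (with_proj Z') (map \<pi> vs ! i)) = g i"
      by (simp_all add: g_def deg' nth_V n_def)
    note ev = poly_char_poly_graph_matrices[OF len(1) carr(1) adj g(1) fin(1) sym(1)]
    note ev' = poly_char_poly_graph_matrices[OF len(2) carr(2) adj' g(2) fin(2) sym(2)]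
    note eval = ev(1) ev'(1) ev(2-4)[where d = "real d"] ev'(2-4)[where d = "real d"]
    note perturb = det_adjacency_perturbation_eq[OF X K \<pi> vs len(1)]
    have supp_b: "vs ! i \<in> K \<and> vs ! j \<in> K" if "b i j \<noteq> 0" for i j
      using that D(1) by (auto simp: b_def split: if_splits)
    have supp_g: "vs ! i \<in> K" if "g i \<noteq> real d" "i < n" for i
      using that deg_d[of "vs ! i"] nth_V by (auto simp: g_def n_def)
    \<comment> \<open>For \<open>d = 0\<close> the substitute degree 1 leaves \<open>- x\<close>.
      Otherwise \<open>d \<ge> 1\<close>, and \<open>- x * real d \<ge> - x\<close> because
      \<open>x\<close> is negative.\<close>
    have y4: "real n < real d - x * (if real d = 0 then 1 else real d)" if "x < - real n" for x
    proof (cases "d = 0")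
      case False
      hence "- x * 1 \<le> - x * real d"
        using that by (intro mult_left_mono) auto
      hence "real n < real d - x * real d"
        using that by (simp only: mult_1_right mult_minus_left)
      thus ?thesis using False by simp
    qed (use that in simp)
    \<comment> \<open>One support argument serves the three corrections with a diagonal part:
      \<open>t\<close> is a correction entry, and the last premise says that it can be nonzero only
      at a deleted arc or at a diagonal position whose degree has changed.\<close>
    have supp: "vs ! i \<in> K \<and> vs ! j \<in> K"
      if "i < n" "t \<noteq> 0" and "b i j = 0 \<Longrightarrow> i \<noteq> j \<or> g i = real d \<Longrightarrow> t = 0"
      for i j and t :: real
    proof (cases "b i j = 0")
      case True
      hence "i = j" "g i \<noteq> real d" using that by blast+
      thus ?thesis using supp_g that(1) by blast
    qed (rule supp_b)
    have "char_poly (adjacency_matrix vs Z) = char_poly (adjacency_matrix (map \<pi> vs) Z')"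
    proof (rule poly_eqI_below[where c = "- real n"])
      fix x assume "x < - real n"
      hence y: "real n < \<bar>x\<bar>" by simp
      show "poly (char_poly (adjacency_matrix vs Z)) x = poly (char_poly (adjacency_matrix (map \<pi> vs) Z')) x"
        unfolding eval by (rule perturb[OF y]) (use supp_b in blast)
    qed
    moreover have "char_poly (laplacian_matrix vs Z) = char_poly (laplacian_matrix (map \<pi> vs) Z')"
    proof (rule poly_eqI_below[where c = "- real n"])
      fix x assume "x < - real n"
      hence y: "real n < \<bar>real d - x\<bar>" by simp
      define c where "c i j = b i j + (if i = j then g i - real d else 0)" for i j
      have "vs ! i \<in> K \<and> vs ! j \<in> K" if "i < n" "j < n" "c i j \<noteq> 0" for i j
        by (rule supp[OF that(1,3)]) (auto simp: c_def)
      hence "\<forall>i<n. \<forall>j<n. c i j \<noteq> 0 \<longrightarrow> vs ! i \<in> K \<and> vs ! j \<in> K" by blast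
      note perturb[OF y this]
      thus "poly (char_poly (laplacian_matrix vs Z)) x = poly (char_poly (laplacian_matrix (map \<pi> vs) Z')) x"
        unfolding eval c_def by (simp only:)
    qed
    moreover have "char_poly (unsigned_laplacian_matrix vs Z)
        = char_poly (unsigned_laplacian_matrix (map \<pi> vs) Z')"
    proof (rule poly_eqI_below[where c = "- real n"])
      fix x assume "x < - real n"
      hence y: "real n < \<bar>x - real d\<bar>" by simp
      define c where "c i j = b i j - (if i = j then g i - real d else 0)" for i j
      have "vs ! i \<in> K \<and> vs ! j \<in> K" if "i < n" "j < n" "c i j \<noteq> 0" for i j
        by (rule supp[OF that(1,3)]) (auto simp: c_def)
      hence "\<forall>i<n. \<forall>j<n. c i j \<noteq> 0 \<longrightarrow> vs ! i \<in> K \<and> vs ! j \<in> K" by blast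
      note perturb[OF y this]
      thus "poly (char_poly (unsigned_laplacian_matrix vs Z)) x
          = poly (char_poly (unsigned_laplacian_matrix (map \<pi> vs) Z')) x"
        unfolding eval c_def by (simp only:)
    qed
    moreover have "char_poly (normalized_laplacian_matrix vs Z)
        = char_poly (normalized_laplacian_matrix (map \<pi> vs) Z')"
    proof (rule poly_eqI_below[where c = "- real n"])
      fix x assume "x < - real n"
      hence y: "real n < \<bar>real d - x * (if real d = 0 then 1 else real d)\<bar>"
        using y4[of x] by linarith
      \<comment> \<open>Where \<open>g i = real d\<close>, the substitute degrees coincide as well,
        so the multiple of \<open>x\<close> vanishes together with the degree excess.\<close>
      define c where "c i j = b i j + (if i = j then g i - real d
        - x * ((if g i = 0 then 1 else g i) - (if real d = 0 then 1 else real d)) else 0)" for i j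
      have "vs ! i \<in> K \<and> vs ! j \<in> K" if "i < n" "j < n" "c i j \<noteq> 0" for i j
        by (rule supp[OF that(1,3)]) (auto simp: c_def)
      hence "\<forall>i<n. \<forall>j<n. c i j \<noteq> 0 \<longrightarrow> vs ! i \<in> K \<and> vs ! j \<in> K" by blast
      note perturb[OF y this]
      thus "poly (char_poly (normalized_laplacian_matrix vs Z)) x
          = poly (char_poly (normalized_laplacian_matrix (map \<pi> vs) Z')) x"
        unfolding eval c_def by (simp only:)
    qed
    \<comment> \<open>The comparison was made along \<open>map \<pi> vs\<close>, one enumeration of
      \<open>Z'\<close>; the given \<open>ws\<close> is another.\<close>
    ultimately show ?thesis
      using char_poly_graph_matrices_enumeration_independent[OF \<pi>vs ws] by simp
  qed
  thus ?thesis unfolding cospectral_def by blast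
qed

theorem theorem3p6:
  fixes X :: "'a pair_pre_digraph" and Y :: "'b pair_pre_digraph"
    and \<iota>\<^sub>1 \<iota>\<^sub>2 :: "'b \<Rightarrow> 'a"
  assumes "pair_graph X" and "one_walk_regular X"
    and "pair_graph Y" and "card (pverts Y) \<le> clique_number X"
    and "inj_on \<iota>\<^sub>1 (pverts Y)" and "is_clique X (\<iota>\<^sub>1 ` pverts Y)"
    and "inj_on \<iota>\<^sub>2 (pverts Y)" and "is_clique X (\<iota>\<^sub>2 ` pverts Y)"
  shows "cospectral adjacency_matrix (delete_copy X Y \<iota>\<^sub>1) (delete_copy X Y \<iota>\<^sub>2)
    \<and> cospectral laplacian_matrix (delete_copy X Y \<iota>\<^sub>1) (delete_copy X Y \<iota>\<^sub>2)
    \<and> cospectral unsigned_laplacian_matrix (delete_copy X Y \<iota>\<^sub>1) (delete_copy X Y \<iota>\<^sub>2)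
    \<and> cospectral normalized_laplacian_matrix (delete_copy X Y \<iota>\<^sub>1) (delete_copy X Y \<iota>\<^sub>2)"
proof -
  interpret X: pair_graph X by fact
  interpret Y: pair_graph Y by fact
  let ?K = "\<iota>\<^sub>1 ` pverts Y"
  define D where "D f = {(f a, f b) | a b. (a, b) \<in> parcs Y}" for f :: "'b \<Rightarrow> 'a"
  obtain \<pi> where \<pi>: "bij_betw \<pi> (pverts X) (pverts X)" "\<And>a. a \<in> pverts Y \<Longrightarrow> \<pi> (\<iota>\<^sub>1 a) = \<iota>\<^sub>2 a"
    using ex_bij_betw_extending[OF X.pair_finite_verts assms(5) _ assms(7)] assms(6,8)
    unfolding is_clique_def by metis
  have arcsY: "a \<in> pverts Y" "b \<in> pverts Y" "a \<noteq> b" if "(a, b) \<in> parcs Y" for a b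
    using that Y.pair_no_loops[of "(a, b)"] by (auto dest: Y.in_arcsD1 Y.in_arcsD2)
  \<comment> \<open>As \<open>Y\<close> has no loops and \<open>f\<close> is injective, the ends of
    an arc go to distinct vertices of a clique, which are adjacent in \<open>X\<close>.\<close>
  have sub: "D f \<subseteq> parcs X" if "inj_on f (pverts Y)" "is_clique X (f ` pverts Y)" for f
    using that arcsY unfolding D_def is_clique_def by (fastforce simp: inj_on_eq_iff)
  have 1: "D \<iota>\<^sub>1 \<subseteq> ?K \<times> ?K"
    using arcsY by (auto simp: D_def)
  have 2: "sym (D \<iota>\<^sub>1)"
    using Y.pair_sym_arcs unfolding D_def symmetric_def sym_def by auto
  have 3: "D \<iota>\<^sub>2 = map_prod \<pi> \<pi> ` D \<iota>\<^sub>1"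
  proof -
    have D: "D f = (\<lambda>(a, b). (f a, f b)) ` parcs Y" for f
      by (auto simp: D_def)
    show ?thesis
      unfolding D image_image using \<pi>(2) arcsY by (intro image_cong) auto
  qed
  have "\<pi> ` ?K = \<iota>\<^sub>2 ` pverts Y"
    using \<pi>(2) by (simp add: image_image)
  hence "is_clique X (\<pi> ` ?K)" using assms(8) by simp
  from delete_arcs_in_cliques_cospectral[OF assms(1,2,6) this \<pi>(1) 1 sub[OF assms(5,6)] 2 3 sub[OF assms(7,8)]]
  show ?thesis
    unfolding delete_copy_def D_def .
qed

end
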